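(* Let $n\ge 1$ be an integer, let $q_0=1$ and $0<q_i<1$ for $i=1,\dots,n$, and let $a_0,a_1,\dots,a_n\in\mathbb{R}$. The power series $$\mathcal{R}(\bar a;\bar q;x)=\sum_{m=0}^\infty \frac{x^m}{m!}(\bar a;\bar q)_m$$ has infinite radius of convergence.
   Context: Notation: $\bar a=(a_0,\dots,a_n)$, $\bar q=(q_0,\dots,q_n)$, and $(\bar a;\bar q)_m=\prod_{j=0}^{m-1}\left(\sum_{i=0}^n a_iq_i^j\right)$ for $m\ge 1$, with $(\bar a;\bar q)_0=1$. *)

theory Defs
  imports "HOL-Analysis.Analysis"
begin

text \<open>
  The tuples \<open>(a\<^sub>0, \<dots>, a\<^sub>n)\<close> and \<open>(q\<^sub>0, \<dots>, q\<^sub>n)\<close> are given by functions on the natural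
  numbers, of which only the values at indices \<open>i \<le> n\<close> matter.
\<close>

definition multi_q_poch :: "nat \<Rightarrow> (nat \<Rightarrow> real) \<Rightarrow> (nat \<Rightarrow> real) \<Rightarrow> nat \<Rightarrow> real" where
  "multi_q_poch n a q m = (\<Prod>j<m. \<Sum>i\<le>n. a i * q i ^ j)"

text \<open>The power series \<open>\<R>(a; q; x)\<close> in the variable \<open>x\<close>, as a formal power series.\<close>

definition R_series :: "nat \<Rightarrow> (nat \<Rightarrow> real) \<Rightarrow> (nat \<Rightarrow> real) \<Rightarrow> real fps" where
  "R_series n a q = Abs_fps (\<lambda>m. multi_q_poch n a q m / fact m)"

end

theory Submission imports Defs begin

text \<open>
  All bases satisfy \<open>\<bar>q i\<bar> \<le> 1\<close>, so each factor \<open>\<Sum>i\<le>n. a i * q i ^ j\<close> is bounded by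
  \<open>M = (\<Sum>i\<le>n. \<bar>a i\<bar>)\<close> uniformly in \<open>j\<close>. The product of the first \<open>m\<close> factors is
  then at most \<open>M ^ m\<close> in absolute value, and the series is dominated coefficientwise by
  the exponential series of \<open>M * x\<close>, which converges everywhere.
\<close>

lemma abs_multi_q_poch_le:
  assumes "\<And>i. i \<le> n \<Longrightarrow> \<bar>q i\<bar> \<le> 1"
  shows "\<bar>multi_q_poch n a q m\<bar> \<le> (\<Sum>i\<le>n. \<bar>a i\<bar>) ^ m"
proof -
  have factor_le: "\<bar>\<Sum>i\<le>n. a i * q i ^ j\<bar> \<le> (\<Sum>i\<le>n. \<bar>a i\<bar>)" for j
  proof -
    have "\<bar>\<Sum>i\<le>n. a i * q i ^ j\<bar> \<le> (\<Sum>i\<le>n. \<bar>a i * q i ^ j\<bar>)"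
      by (rule sum_abs)
    also have "\<dots> \<le> (\<Sum>i\<le>n. \<bar>a i\<bar>)"
      using assms by (intro sum_mono) (auto simp: abs_mult power_abs intro!: mult_left_le power_le_one)
    finally show ?thesis .
  qed
  have "\<bar>multi_q_poch n a q m\<bar> = (\<Prod>j<m. \<bar>\<Sum>i\<le>n. a i * q i ^ j\<bar>)"
    by (simp add: multi_q_poch_def abs_prod)
  also have "\<dots> \<le> (\<Prod>j<m. \<Sum>i\<le>n. \<bar>a i\<bar>)"
    by (intro prod_mono) (simp add: factor_le)
  finally show ?thesis by simp
qed

theorem theorem6p1:
  fixes n :: nat and a q :: "nat \<Rightarrow> real"
  assumes "n \<ge> 1"
    and "q 0 = 1"
    and "\<And>i. 1 \<le> i \<Longrightarrow> i \<le> n \<Longrightarrow> 0 < q i \<and> q i < 1"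
  shows "fps_conv_radius (R_series n a q) = \<infinity>"
proof -
  define M where "M = (\<Sum>i\<le>n. \<bar>a i\<bar>)"
  have q_le: "\<bar>q i\<bar> \<le> 1" if "i \<le> n" for i
    using assms(2) assms(3)[of i] that by (cases "i = 0") auto
  have coeff_le: "\<bar>multi_q_poch n a q m\<bar> \<le> M ^ m" for m
    unfolding M_def by (rule abs_multi_q_poch_le) (rule q_le)
  have "summable (\<lambda>m. fps_nth (R_series n a q) m * x ^ m)" for x :: real
  proof (rule summable_comparison_test')
    show "summable (\<lambda>m. inverse (fact m) * (M * \<bar>x\<bar>) ^ m)"
      by (rule summable_exp)
    show "norm (fps_nth (R_series n a q) m * x ^ m) \<le> inverse (fact m) * (M * \<bar>x\<bar>) ^ m" for m
      using mult_right_mono[OF coeff_le[of m], of "\<bar>x\<bar> ^ m / fact m"]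
      by (simp add: R_series_def abs_mult power_abs power_mult_distrib field_simps)
  qed
  then show ?thesis
    unfolding fps_conv_radius_def by (rule conv_radius_inftyI'')
qed

end
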